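(* For $t\in[0,1]$ define the following subsets of $\mathbb{R}^2$: $\Gamma_t^+$ is the closed line segment with endpoints $(-1,t)$ and $(1,1-t)$, $\Gamma_t^-$ is the closed line segment with endpoints $(-1,-t)$ and $(1,t-1)$, and $\Gamma_t=\Gamma_t^+\cup\Gamma_t^-$. Let $\mu_0$ and $\mu_1$ be the normalized arclength measures on $\Gamma_0$ and $\Gamma_1$ respectively. Then there exists a unique quadratic optimal coupling $\pi$ between $\mu_0$ and $\mu_1$, and for every $t\in[0,1]$ the displacement interpolation $\mu_t$ is the normalized arclength measure on $\Gamma_t$.
   Context: The normalized arclength measure on a finite union $\Gamma$ of segments is the one-dimensional Hausdorff measure restricted to $\Gamma$, divided by the total length of $\Gamma$. A quadratic optimal coupling of $\mu_0$ and $\mu_1$ is a minimizer of $\int|x-y|^2\,\mathrm{d}\pi(x,y)$ among all couplings $\pi$ of $\mu_0$ and $\mu_1$ ($|\cdot|$ the Euclidean norm). Given the unique quadratic optimal coupling $\pi$, the displacement interpolation is $\mu_t=\bigl((x,y)\mapsto(1-t)x+ty\bigr)_\#\pi$, $t\in[0,1]$, where $T_\#\pi$ denotes the image of $\pi$ under $T$. *)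

theory Defs
  imports "HOL-Analysis.Analysis"
begin

(* The one-dimensional Hausdorff outer measure. The dimensional constant is 1, so that segments
   receive their Euclidean length. Boundedness of the covering sets is required explicitly because
   diameter is only meaningful for bounded sets. *)
definition hausdorff1_delta :: "real \<Rightarrow> 'a::metric_space set \<Rightarrow> ennreal" where
  "hausdorff1_delta \<delta> A =
     (INF U \<in> {U :: nat \<Rightarrow> 'a set. A \<subseteq> (\<Union>i. U i) \<and> (\<forall>i. bounded (U i) \<and> diameter (U i) \<le> \<delta>)}.
        \<Sum>i. ennreal (diameter (U i)))"

definition hausdorff1_outer :: "'a::metric_space set \<Rightarrow> ennreal" where
  "hausdorff1_outer A = (SUP \<delta> \<in> {0<..}. hausdorff1_delta \<delta> A)"

(* As a metric outer measure, hausdorff1_outer is countably additive on the Borel sets, so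
   measure_of does not fall back to the null measure here. *)
definition hausdorff1 :: "'a::metric_space measure" where
  "hausdorff1 = measure_of UNIV (sets borel) hausdorff1_outer"

(* uniform_measure M S is M restricted to S and divided by emeasure M S. *)
definition normalized_arclength :: "'a::metric_space set \<Rightarrow> 'a measure" where
  "normalized_arclength S = uniform_measure hausdorff1 S"

definition couplings :: "'a measure \<Rightarrow> 'b measure \<Rightarrow> ('a \<times> 'b) measure set" where
  "couplings \<mu> \<nu> =
     {\<pi>. sets \<pi> = sets (\<mu> \<Otimes>\<^sub>M \<nu>) \<and> distr \<pi> \<mu> fst = \<mu> \<and> distr \<pi> \<nu> snd = \<nu>}"

definition quadratic_cost :: "('a::euclidean_space \<times> 'a) measure \<Rightarrow> ennreal" where
  "quadratic_cost \<pi> = (\<integral>\<^sup>+ (x, y). ennreal ((norm (x - y))\<^sup>2) \<partial>\<pi>)"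

definition quadratic_optimal_coupling ::
    "'a::euclidean_space measure \<Rightarrow> 'a measure \<Rightarrow> ('a \<times> 'a) measure \<Rightarrow> bool" where
  "quadratic_optimal_coupling \<mu> \<nu> \<pi> \<longleftrightarrow>
     \<pi> \<in> couplings \<mu> \<nu> \<and> (\<forall>\<pi>' \<in> couplings \<mu> \<nu>. quadratic_cost \<pi> \<le> quadratic_cost \<pi>')"

definition displacement_interpolation ::
    "('a::euclidean_space \<times> 'a) measure \<Rightarrow> real \<Rightarrow> 'a measure" where
  "displacement_interpolation \<pi> t = distr \<pi> borel (\<lambda>(x, y). (1 - t) *\<^sub>R x + t *\<^sub>R y)"

(* The plane is real \<times> real, whose norm in HOL-Analysis is the Euclidean one. *)
definition Gam_plus :: "real \<Rightarrow> (real \<times> real) set" where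
  "Gam_plus t = closed_segment (-1, t) (1, 1 - t)"

definition Gam_minus :: "real \<Rightarrow> (real \<times> real) set" where
  "Gam_minus t = closed_segment (-1, - t) (1, t - 1)"

definition Gam :: "real \<Rightarrow> (real \<times> real) set" where
  "Gam t = Gam_plus t \<union> Gam_minus t"

end

theory Submission
  imports Defs
begin

text \<open>Parametrise all the sets \<^term>\<open>Gam t\<close> over the interval from -2 to 2, the sign of the
  parameter selecting the branch, each branch being traversed at constant speed. The normalized
  arclength measures then become images of the one uniform measure on this interval, and for fixed
  parameter the parametrisation is affine in \<open>t\<close>, so it suffices that the unique optimal coupling
  moves \<^term>\<open>Gam 0\<close> to \<^term>\<open>Gam 1\<close> vertically within each branch. For
  points of \<^term>\<open>Gam 0\<close> and \<^term>\<open>Gam 1\<close> with abscissae \<open>s\<close>, \<open>s'\<close> on the same branch the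
  squared distance is \<open>s\<^sup>2 / 2 + s'\<^sup>2 / 2 + 3 (s - s')\<^sup>2 / 4\<close>, and on different branches it is larger
  by \<open>(1 + s) (1 - s')\<close>. Hence \<open>s\<^sup>2 / 2\<close> and \<open>s'\<^sup>2 / 2\<close> are dual potentials.\<close>

subsection \<open>Metric outer measures and the Hausdorff measure\<close>

text \<open>Caratheodory's criterion: the part of \<open>A\<close> at distance more than
  \<open>a n\<close> from \<open>C\<close> is separated from \<open>A \<inter> C\<close>, so
  \<open>f\<close> adds on these two. What is lost near \<open>C\<close> is a union of thin rings
  whose \<open>f\<close>-values have a finite sum, so their tails are negligible.\<close>

lemma lambda_system_closed:
  fixes f :: "'a::metric_space set \<Rightarrow> ennreal"
  assumes outer: "outer_measure_space UNIV f"
    and sep: "\<And>A B e. 0 < e \<Longrightarrow> (\<And>x y. x \<in> A \<Longrightarrow> y \<in> B \<Longrightarrow> e \<le> dist x y) \<Longrightarrow>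
                 f A + f B \<le> f (A \<union> B)"
    and C: "closed C"
  shows "C \<in> lambda_system UNIV UNIV f"
proof -
  have empty: "f {} = 0" and mono: "\<And>A B. A \<subseteq> B \<Longrightarrow> f A \<le> f B"
    and csub: "countably_subadditive UNIV f"
    using outer by (auto simp: outer_measure_space_def positive_def increasing_def)
  \<comment> \<open>\<open>countably_subadditive\<close> speaks of disjoint families only;
    \<open>disjointed\<close> together with monotonicity extends it to arbitrary sequences.\<close>
  have csubU: "f (\<Union>i. A i) \<le> (\<Sum>i. f (A i))" for A :: "nat \<Rightarrow> 'a set"
  proof -
    have "f (\<Union>i. A i) = f (\<Union>i. disjointed A i)"
      by (simp add: UN_disjointed_eq)
    also have "\<dots> \<le> (\<Sum>i. f (disjointed A i))"
      using csub disjoint_family_disjointed[of A] by (simp add: countably_subadditive_def)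
    also have "\<dots> \<le> (\<Sum>i. f (A i))"
      by (intro suminf_le mono disjointed_subset) auto
    finally show ?thesis .
  qed
  have sub2: "f (A \<union> B) \<le> f A + f B" for A B
  proof -
    have "f (A \<union> B) \<le> (\<Sum>i. f (binaryset A B i))"
      using csubU[of "binaryset A B"] by (simp add: UN_binaryset_eq)
    also have "\<dots> = f A + f B"
      by (simp add: suminf_binaryset_eq empty)
    finally show ?thesis .
  qed
  \<comment> \<open>Nonemptiness is needed because \<open>infdist x {} = 0\<close> by convention, so
    that the zero set of \<open>h\<close> would not be \<open>C\<close>.\<close>
  have le: "f (A \<inter> C) + f (A - C) \<le> f A" if ne: "C \<noteq> {}" for A
  proof (cases "f A = top")
    case True then show ?thesis by simp
  next
    case fin: False
    define h where "h x = infdist x C" for x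
    define a where "a k = 1 / (real k + 1)" for k
    \<comment> \<open>Rings and outer parts are indexed so that \<open>U (k + 1)\<close> together
      with \<open>R k\<close> is exactly \<open>U (k + 2)\<close>.\<close>
    define R where "R k = {x \<in> A. a (k + 2) < h x \<and> h x \<le> a (k + 1)}" for k
    define U where "U k = {x \<in> A. a k < h x}" for k
    have hC: "h x = 0 \<longleftrightarrow> x \<in> C" and h0: "0 \<le> h x" for x
      using in_closed_iff_infdist_zero[OF C ne] by (auto simp: h_def infdist_nonneg)
    have h_lip: "h x \<le> h y + dist x y" for x y
      by (simp add: h_def infdist_triangle)
    have a_dec: "a (Suc k) < a k" and a_pos: "0 < a k" for k
      by (auto simp: a_def field_simps)
    \<comment> \<open>Adjacent rings can touch, but rings of equal parity cannot: on
      \<open>U m\<close> the function \<open>h\<close> exceeds \<open>a m\<close>, on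
      \<open>R m\<close> it is at most \<open>a (Suc m)\<close>. Both sets lie in
      \<open>U (m + 2)\<close>, so the next ring of the same parity is absorbed additively.\<close>
    have parity: "(\<Sum>k<n. f (R (2 * k + j))) \<le> f (U (2 * n + j))" for n j
    proof (induction n)
      case 0 then show ?case by simp
    next
      case (Suc n)
      let ?m = "2 * n + j"
      have "(\<Sum>k<Suc n. f (R (2 * k + j))) \<le> f (U ?m) + f (R ?m)"
        using Suc by (simp add: add_right_mono)
      also have "\<dots> \<le> f (U ?m \<union> R ?m)"
      proof (rule sep)
        show "0 < a ?m - a (Suc ?m)" using a_dec[of ?m] by simp
        fix x y assume "x \<in> U ?m" "y \<in> R ?m"
        then show "a ?m - a (Suc ?m) \<le> dist x y"
          using h_lip[of x y] by (auto simp: U_def R_def)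
      qed
      also have "\<dots> \<le> f (U (2 * Suc n + j))"
        using a_dec[of ?m] a_dec[of "Suc ?m"] by (intro mono) (auto simp: U_def R_def)
      finally show ?case .
    qed
    have parity': "(\<Sum>k<n. f (R (2 * k + j))) \<le> f A" for n j
      using parity mono by (rule order_trans) (auto simp: U_def)
    have split: "(\<Sum>k<2*n. f (R k)) = (\<Sum>k<n. f (R (2 * k + 0))) + (\<Sum>k<n. f (R (2 * k + 1)))" for n
      by (induction n) (simp_all add: algebra_simps)
    have "(\<Sum>k<n. f (R k)) \<le> f A + f A" for n
    proof -
      have "(\<Sum>k<n. f (R k)) \<le> (\<Sum>k<2*n. f (R k))" by (intro sum_mono2) auto
      also have "\<dots> \<le> f A + f A" unfolding split by (intro add_mono parity')
      finally show ?thesis .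
    qed
    then have "(\<Sum>k. f (R k)) \<le> f A + f A"
      by (intro suminf_le_const) auto
    then have sum_fin: "(\<Sum>k. f (R k)) \<noteq> top"
      using fin by (auto simp: top_unique)
    have tail: "f (A - C) \<le> f (U (n + 1)) + (\<Sum>k. f (R (k + n)))" for n
    proof -
      have "A - C \<subseteq> U (n + 1) \<union> (\<Union>k. R (k + n))"
      proof
        fix x assume x: "x \<in> A - C"
        show "x \<in> U (n + 1) \<union> (\<Union>k. R (k + n))"
        proof (cases "a (n + 1) < h x")
          case True then show ?thesis using x by (simp add: U_def)
        next
          case False
          have "0 < h x" using hC[of x] h0[of x] x by auto
          then obtain N where N: "inverse (real (Suc N)) < h x"
            using reals_Archimedean by blast
          have ex: "\<exists>k. a (k + n + 2) < h x"
            by (rule exI[of _ N], rule le_less_trans[OF _ N]) (simp add: a_def field_simps)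
          \<comment> \<open>Minimality of \<open>k\<close> gives the upper bound on
            \<open>h x\<close> that membership in the ring requires; for \<open>k = 0\<close> that
            bound is the failure of \<open>a (n + 1) < h x\<close>.\<close>
          define k where "k = (LEAST k. a (k + n + 2) < h x)"
          have k1: "a (k + n + 2) < h x"
            unfolding k_def by (rule LeastI_ex[OF ex])
          have k2: "h x \<le> a (k + n + 1)"
          proof (cases k)
            case 0 then show ?thesis using False by simp
          next
            case (Suc k')
            have "\<not> a (k' + n + 2) < h x"
              using not_less_Least[of k' "\<lambda>k. a (k + n + 2) < h x"] Suc by (simp add: k_def)
            then show ?thesis using Suc by simp
          qed
          have "x \<in> R (k + n)" using x k1 k2 by (simp add: R_def)
          then show ?thesis by blast
        qed
      qed
      then have "f (A - C) \<le> f (U (n + 1) \<union> (\<Union>k. R (k + n)))" by (rule mono)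
      also have "\<dots> \<le> f (U (n + 1)) + f (\<Union>k. R (k + n))" by (rule sub2)
      also have "\<dots> \<le> f (U (n + 1)) + (\<Sum>k. f (R (k + n)))"
        by (intro add_left_mono csubU)
      finally show ?thesis .
    qed
    have gap: "f (A \<inter> C) + f (U n) \<le> f A" for n
    proof -
      have "f (A \<inter> C) + f (U n) \<le> f (A \<inter> C \<union> U n)"
      proof (rule sep)
        show "0 < a n" by (rule a_pos)
        fix x y assume xy: "x \<in> A \<inter> C" "y \<in> U n"
        then have "h x = 0" using hC[of x] by auto
        then show "a n \<le> dist x y"
          using h_lip[of y x] xy by (auto simp: U_def dist_commute)
      qed
      also have "\<dots> \<le> f A" by (intro mono) (auto simp: U_def)
      finally show ?thesis .
    qed
    \<comment> \<open>Adding the finite quantity \<open>\<Sum>k. f (R k)\<close> on both sides replaces a limit of tails.\<close>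
    have "(\<Sum>k. f (R k)) + (f (A \<inter> C) + f (A - C)) \<le> (\<Sum>k. f (R k)) + f A"
    proof (rule ennreal_suminf_bound_add)
      fix N
      have "(\<Sum>k<N. f (R k)) + (f (A \<inter> C) + f (A - C))
          \<le> (\<Sum>k<N. f (R k)) + (f (A \<inter> C) + (f (U (N + 1)) + (\<Sum>k. f (R (k + N)))))"
        by (intro add_left_mono tail)
      also have "\<dots> = ((\<Sum>k. f (R (k + N))) + (\<Sum>k<N. f (R k))) + (f (A \<inter> C) + f (U (N + 1)))"
        by (simp add: ac_simps)
      also have "(\<Sum>k. f (R (k + N))) + (\<Sum>k<N. f (R k)) = (\<Sum>k. f (R k))"
        by (rule suminf_offset[symmetric]) simp
      also have "\<dots> + (f (A \<inter> C) + f (U (N + 1))) \<le> (\<Sum>k. f (R k)) + f A"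
        by (intro add_left_mono gap)
      finally show "(\<Sum>k<N. f (R k)) + (f (A \<inter> C) + f (A - C)) \<le> (\<Sum>k. f (R k)) + f A" .
    qed
    then show ?thesis
      using sum_fin by (simp add: ennreal_add_left_cancel_le)
  qed
  have "f (A \<inter> C) + f (A - C) = f A" for A
  proof (rule antisym)
    show "f (A \<inter> C) + f (A - C) \<le> f A"
      by (cases "C = {}") (auto simp: empty le)
    show "f A \<le> f (A \<inter> C) + f (A - C)"
      using sub2[of "A \<inter> C" "A - C"] by (simp add: Int_Diff_Un)
  qed
  then show ?thesis
    by (auto simp: lambda_system_def Int_commute Diff_eq)
qed

text \<open>The Caratheodory-measurable sets form a sigma-algebra containing all closed sets, hence
  all Borel sets, and \<open>f\<close> is a measure on it.\<close>

lemma measure_space_metric_outer_measure: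
  fixes f :: "'a::metric_space set \<Rightarrow> ennreal"
  assumes outer: "outer_measure_space UNIV f"
    and sep: "\<And>A B e. 0 < e \<Longrightarrow> (\<And>x y. x \<in> A \<Longrightarrow> y \<in> B \<Longrightarrow> e \<le> dist x y) \<Longrightarrow>
                 f A + f B \<le> f (A \<union> B)"
  shows "measure_space UNIV (sets borel) f"
proof -
  interpret sigma_algebra "UNIV :: 'a set" UNIV
    using sigma_algebra_Pow[of "UNIV :: 'a set"] by simp
  have ms: "measure_space UNIV (lambda_system UNIV UNIV f) f"
    by (rule caratheodory_lemma[OF outer])
  then interpret L: sigma_algebra UNIV "lambda_system UNIV UNIV f"
    by (simp add: measure_space_def)
  have "C \<in> lambda_system UNIV UNIV f" if "closed C" for C
    using outer sep that by (rule lambda_system_closed)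
  then have "sets borel \<subseteq> lambda_system UNIV UNIV f"
    by (simp add: borel_eq_closed) (rule L.sigma_sets_subset, blast)
  moreover have "sigma_algebra UNIV (sets (borel :: 'a measure))"
    using sets.sigma_algebra_axioms[of "borel :: 'a measure"] by simp
  ultimately show ?thesis
    by (intro measure_down[OF ms])
qed

section \<open>One-dimensional Hausdorff outer measure\<close>

lemma hausdorff1_delta_le:
  "A \<subseteq> (\<Union>i. U i) \<Longrightarrow> (\<And>i. bounded (U i)) \<Longrightarrow> (\<And>i. diameter (U i) \<le> \<delta>) \<Longrightarrow>
   hausdorff1_delta \<delta> A \<le> (\<Sum>i. ennreal (diameter (U i)))"
  unfolding hausdorff1_delta_def by (rule INF_lower) simp

lemma hausdorff1_delta_greatest:
  "(\<And>U. A \<subseteq> (\<Union>i. U i) \<Longrightarrow> (\<And>i. bounded (U i)) \<Longrightarrow> (\<And>i. diameter (U i) \<le> \<delta>) \<Longrightarrow>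
      c \<le> (\<Sum>i. ennreal (diameter (U i)))) \<Longrightarrow> c \<le> hausdorff1_delta \<delta> A"
  unfolding hausdorff1_delta_def by (rule INF_greatest) simp

lemma hausdorff1_delta_cover:
  assumes "hausdorff1_delta \<delta> A < c"
  obtains U where "A \<subseteq> (\<Union>i. U i)" "\<And>i. bounded (U i)" "\<And>i. diameter (U i) \<le> \<delta>"
    "(\<Sum>i. ennreal (diameter (U i))) < c"
  using assms unfolding hausdorff1_delta_def INF_less_iff by blast

lemma hausdorff1_delta_subset: "A \<subseteq> B \<Longrightarrow> hausdorff1_delta \<delta> A \<le> hausdorff1_delta \<delta> B"
  by (rule hausdorff1_delta_greatest) (rule hausdorff1_delta_le, auto)

lemma hausdorff1_delta_antimono: "\<delta> \<le> \<epsilon> \<Longrightarrow> hausdorff1_delta \<epsilon> A \<le> hausdorff1_delta \<delta> A"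
  by (rule hausdorff1_delta_greatest) (rule hausdorff1_delta_le, auto intro: order_trans)

text \<open>Each \<open>A n\<close> is covered optimally up to \<open>e * (1/2)^Suc n\<close>; the
  double sequence of covering sets is enumerated by \<open>prod_decode\<close>, and the errors add
  up to \<open>e\<close>.\<close>

lemma hausdorff1_delta_UN:
  fixes A :: "nat \<Rightarrow> 'a::metric_space set"
  shows "hausdorff1_delta \<delta> (\<Union>n. A n) \<le> (\<Sum>n. hausdorff1_delta \<delta> (A n))"
proof (rule ennreal_le_epsilon)
  fix e :: real assume "0 < e" "(\<Sum>n. hausdorff1_delta \<delta> (A n)) < top"
  then have *: "\<And>n. hausdorff1_delta \<delta> (A n) < hausdorff1_delta \<delta> (A n) + e * (1/2)^Suc n"
    by (auto simp add: less_top dest!: ennreal_suminf_lessD)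
  have "\<exists>U. A n \<subseteq> (\<Union>i. U i) \<and> (\<forall>i. bounded (U i)) \<and> (\<forall>i. diameter (U i) \<le> \<delta>) \<and>
    (\<Sum>i. ennreal (diameter (U i))) \<le> hausdorff1_delta \<delta> (A n) + e * (1/2)^Suc n" for n
    by (rule hausdorff1_delta_cover[OF *[of n]]) (auto intro: less_imp_le)
  then obtain U where U: "\<And>n. A n \<subseteq> (\<Union>i. U n i)" "\<And>n i. bounded (U n i)"
    "\<And>n i. diameter (U n i) \<le> \<delta>"
    "\<And>n. (\<Sum>i. ennreal (diameter (U n i))) \<le> hausdorff1_delta \<delta> (A n) + e * (1/2)^Suc n"
    by metis
  have cover: "(\<Union>n. A n) \<subseteq> (\<Union>i. case_prod U (prod_decode i))"
  proof
    fix x assume "x \<in> (\<Union>n. A n)"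
    then obtain n i where "x \<in> U n i" using U(1) by blast
    then show "x \<in> (\<Union>i. case_prod U (prod_decode i))"
      by (intro UN_I[of "prod_encode (n, i)"]) auto
  qed
  have "hausdorff1_delta \<delta> (\<Union>n. A n)
      \<le> (\<Sum>i. ennreal (diameter (case_prod U (prod_decode i))))"
    using cover by (rule hausdorff1_delta_le) (auto simp: U split: prod.split)
  also have "\<dots> = (\<Sum>n. \<Sum>i. ennreal (diameter (U n i)))"
    by (subst suminf_ennreal_2dimen[where f="\<lambda>p. ennreal (diameter (case_prod U p))", symmetric])
       auto
  also have "\<dots> \<le> (\<Sum>n. hausdorff1_delta \<delta> (A n) + e * (1/2) ^ Suc n)"
    by (intro suminf_le U) auto
  also have "\<dots> = (\<Sum>n. hausdorff1_delta \<delta> (A n)) + (\<Sum>n. ennreal e * ennreal ((1/2) ^ Suc n))"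
    using \<open>0 < e\<close> by (subst suminf_add[symmetric])
      (auto simp del: ennreal_suminf_cmult simp add: ennreal_mult[symmetric])
  also have "\<dots> = (\<Sum>n. hausdorff1_delta \<delta> (A n)) + e"
    unfolding ennreal_suminf_cmult
    by (subst suminf_ennreal_eq[OF zero_le_power power_half_series]) auto
  finally show "hausdorff1_delta \<delta> (\<Union>n. A n) \<le> (\<Sum>n. hausdorff1_delta \<delta> (A n)) + e" .
qed

text \<open>A set of diameter at most \<open>\<delta>\<close>, which is less than \<open>e\<close>,
  cannot meet both \<open>A\<close> and \<open>B\<close>, so a cover of the union splits into a
  cover of each.\<close>

lemma hausdorff1_delta_Un_separated:
  fixes A B :: "'a::metric_space set"
  assumes "\<delta> < e" and sep: "\<And>x y. x \<in> A \<Longrightarrow> y \<in> B \<Longrightarrow> e \<le> dist x y"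
  shows "hausdorff1_delta \<delta> A + hausdorff1_delta \<delta> B \<le> hausdorff1_delta \<delta> (A \<union> B)"
proof (rule hausdorff1_delta_greatest)
  fix U :: "nat \<Rightarrow> 'a set"
  assume cover: "A \<union> B \<subseteq> (\<Union>i. U i)" and bdd: "\<And>i. bounded (U i)"
    and diam: "\<And>i. diameter (U i) \<le> \<delta>"
  \<comment> \<open>Sets that miss \<open>S\<close> become empty, of diameter 0, instead of being
    removed. Both subcovers keep the index set of \<open>U\<close>, and their diameters can be
    compared termwise.\<close>
  define V where "V S i = (if U i \<inter> S = {} then {} else U i)" for S i
  have V: "hausdorff1_delta \<delta> S \<le> (\<Sum>i. ennreal (diameter (V S i)))" if "S \<subseteq> A \<union> B" for S
  proof (rule hausdorff1_delta_le)
    show "S \<subseteq> (\<Union>i. V S i)" using that cover by (fastforce simp: V_def)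
    show "diameter (V S i) \<le> \<delta>" for i
      using diam[of i] diameter_ge_0[OF bdd[of i]] by (auto simp: V_def)
  qed (auto simp: V_def bdd)
  have "ennreal (diameter (V A i)) + ennreal (diameter (V B i)) \<le> ennreal (diameter (U i))" for i
  proof -
    have "V A i = {} \<or> V B i = {}"
    proof (rule ccontr)
      assume "\<not> ?thesis"
      then obtain x y where "x \<in> U i" "x \<in> A" "y \<in> U i" "y \<in> B"
        by (auto simp: V_def split: if_splits)
      then show False
        using sep[of x y] diameter_bounded_bound[OF bdd[of i], of x y] diam[of i] \<open>\<delta> < e\<close>
        by linarith
    qed
    then show ?thesis by (elim disjE) (simp_all add: V_def)
  qed
  then have "(\<Sum>i. ennreal (diameter (V A i)) + ennreal (diameter (V B i)))
      \<le> (\<Sum>i. ennreal (diameter (U i)))"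
    by (intro suminf_le) auto
  then have "(\<Sum>i. ennreal (diameter (V A i))) + (\<Sum>i. ennreal (diameter (V B i)))
      \<le> (\<Sum>i. ennreal (diameter (U i)))"
    by (simp add: suminf_add)
  with V[of A] V[of B] show "hausdorff1_delta \<delta> A + hausdorff1_delta \<delta> B
      \<le> (\<Sum>i. ennreal (diameter (U i)))"
    by (meson Un_upper1 Un_upper2 add_mono order_trans)
qed

lemma outer_measure_space_hausdorff1_outer:
  "outer_measure_space UNIV (hausdorff1_outer :: 'a::metric_space set \<Rightarrow> ennreal)"
  unfolding outer_measure_space_def
proof (intro conjI)
  have "hausdorff1_delta \<delta> ({} :: 'a set) = 0" if "0 < \<delta>" for \<delta>
    using hausdorff1_delta_le[of "{} :: 'a set" "\<lambda>_. {}" \<delta>] that by simp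
  then show "positive UNIV (hausdorff1_outer :: 'a set \<Rightarrow> ennreal)"
    by (simp add: positive_def hausdorff1_outer_def SUP_eq_const)
  show "increasing UNIV (hausdorff1_outer :: 'a set \<Rightarrow> ennreal)"
    by (auto simp: increasing_def hausdorff1_outer_def intro!: SUP_mono' hausdorff1_delta_subset)
  show "countably_subadditive UNIV (hausdorff1_outer :: 'a set \<Rightarrow> ennreal)"
    unfolding countably_subadditive_def
  proof (intro allI impI)
    fix A :: "nat \<Rightarrow> 'a set"
    have "hausdorff1_delta \<delta> (\<Union>i. A i) \<le> (\<Sum>i. hausdorff1_outer (A i))" if "0 < \<delta>" for \<delta>
    proof (rule order_trans[OF hausdorff1_delta_UN])
      show "(\<Sum>n. hausdorff1_delta \<delta> (A n)) \<le> (\<Sum>i. hausdorff1_outer (A i))"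
        using that by (intro suminf_le) (auto simp: hausdorff1_outer_def intro!: SUP_upper)
    qed
    then show "hausdorff1_outer (\<Union>i. A i) \<le> (\<Sum>i. hausdorff1_outer (A i))"
      by (auto simp: hausdorff1_outer_def intro!: SUP_least)
  qed
qed

text \<open>\<open>hausdorff1_delta\<close> grows as its threshold shrinks. Hence the sum of the
  suprema is the supremum of the sums, and any threshold may be replaced by one below
  \<open>e\<close>.\<close>

lemma hausdorff1_outer_Un_separated:
  fixes A B :: "'a::metric_space set"
  assumes "0 < e" and sep: "\<And>x y. x \<in> A \<Longrightarrow> y \<in> B \<Longrightarrow> e \<le> dist x y"
  shows "hausdorff1_outer A + hausdorff1_outer B \<le> hausdorff1_outer (A \<union> B)"
proof -
  have "hausdorff1_outer A + hausdorff1_outer B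
      = (SUP \<delta> \<in> {0<..}. hausdorff1_delta \<delta> A + hausdorff1_delta \<delta> B)"
    unfolding hausdorff1_outer_def
  proof (rule SUP_add_directed_ennreal[symmetric])
    fix i j :: real assume "i \<in> {0<..}" "j \<in> {0<..}"
    then show "\<exists>k\<in>{0<..}. hausdorff1_delta i A + hausdorff1_delta j B
        \<le> hausdorff1_delta k A + hausdorff1_delta k B"
      by (intro bexI[of _ "min i j"] add_mono hausdorff1_delta_antimono) auto
  qed
  also have "\<dots> \<le> hausdorff1_outer (A \<union> B)"
  proof (rule SUP_least)
    fix \<delta> :: real assume "\<delta> \<in> {0<..}"
    have "hausdorff1_delta \<delta> A + hausdorff1_delta \<delta> B
        \<le> hausdorff1_delta (min \<delta> (e / 2)) A + hausdorff1_delta (min \<delta> (e / 2)) B"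
      by (intro add_mono hausdorff1_delta_antimono) auto
    also have "\<dots> \<le> hausdorff1_delta (min \<delta> (e / 2)) (A \<union> B)"
      using \<open>0 < e\<close> by (intro hausdorff1_delta_Un_separated[where e=e] sep) auto
    also have "\<dots> \<le> hausdorff1_outer (A \<union> B)"
      unfolding hausdorff1_outer_def using \<open>0 < e\<close> \<open>\<delta> \<in> {0<..}\<close> by (intro SUP_upper) auto
    finally show "hausdorff1_delta \<delta> A + hausdorff1_delta \<delta> B \<le> hausdorff1_outer (A \<union> B)" .
  qed
  finally show ?thesis .
qed

lemma space_hausdorff1 [simp]: "space hausdorff1 = UNIV"
  by (simp add: hausdorff1_def space_measure_of_conv)

lemma sets_hausdorff1 [simp, measurable_cong]: "sets hausdorff1 = sets borel"
  using sets.sigma_sets_eq[of borel] by (simp add: hausdorff1_def sets_measure_of_conv)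

lemma measure_space_hausdorff1_outer:
  "measure_space UNIV (sets borel) (hausdorff1_outer :: 'a::metric_space set \<Rightarrow> ennreal)"
  using outer_measure_space_hausdorff1_outer hausdorff1_outer_Un_separated
  by (rule measure_space_metric_outer_measure)

text \<open>This is where \<open>measure_of\<close> is shown not to fall back to the null measure,
  since \<open>hausdorff1_outer\<close> is a measure on the Borel sets.\<close>

lemma emeasure_hausdorff1:
  fixes A :: "'a::metric_space set"
  shows "A \<in> sets borel \<Longrightarrow> emeasure hausdorff1 A = hausdorff1_outer A"
  unfolding hausdorff1_def
  using measure_space_hausdorff1_outer[where 'a='a]
  by (intro emeasure_measure_of_sigma) (simp_all add: measure_space_def)

subsection \<open>Hausdorff measure of a segment\<close>

text \<open>Any cover of the image pulls back to intervals of total length at most the sum of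
  diameters divided by \<open>L\<close>, and Lebesgue measure is countably subadditive. Fineness of
  the cover is irrelevant to this bound, so the threshold 1 serves.\<close>

lemma hausdorff1_outer_scaled_isometry_ge:
  fixes g :: "real \<Rightarrow> 'a::metric_space"
  assumes L: "0 < L" and g: "\<And>s t. dist (g s) (g t) = L * \<bar>s - t\<bar>"
    and B: "B \<in> sets borel"
  shows "ennreal L * emeasure lborel B \<le> hausdorff1_outer (g ` B)"
proof -
  have "ennreal L * emeasure lborel B \<le> hausdorff1_delta 1 (g ` B)"
  proof (rule hausdorff1_delta_greatest)
    fix U :: "nat \<Rightarrow> 'a set"
    assume cover: "g ` B \<subseteq> (\<Union>i. U i)" and bdd: "\<And>i. bounded (U i)"
    \<comment> \<open>The interval is the hull of the preimage from \<open>Inf\<close> to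
      \<open>Sup\<close>, or degenerate when the preimage is empty.\<close>
    have "\<exists>a b. a \<le> b \<and> g -` U i \<subseteq> {a..b} \<and> L * (b - a) \<le> diameter (U i)" for i
    proof (cases "g -` U i = {}")
      case True
      then show ?thesis
        using diameter_ge_0[OF bdd[of i]] by (intro exI[of _ 0]) simp
    next
      case False
      let ?S = "g -` U i"
      have diam: "\<bar>s - t\<bar> \<le> diameter (U i) / L" if "s \<in> ?S" "t \<in> ?S" for s t
        using diameter_bounded_bound[OF bdd[of i], of "g s" "g t"] that L g[of s t]
        by (simp add: field_simps)
      obtain s0 where s0: "s0 \<in> ?S" using False by blast
      have ab: "s0 - diameter (U i) / L \<le> s" "s \<le> s0 + diameter (U i) / L" if "s \<in> ?S" for s
        using diam[OF that s0] by auto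
      have bd: "bdd_above ?S" "bdd_below ?S"
        using ab by (meson bdd_aboveI bdd_belowI)+
      have in_I: "s \<in> {Inf ?S..Sup ?S}" if "s \<in> ?S" for s
        using that bd by (simp add: cInf_lower cSup_upper del: vimage_eq)
      have "Sup ?S \<le> Inf ?S + diameter (U i) / L"
      proof (rule cSup_least[OF False])
        fix s assume s: "s \<in> ?S"
        have "s - diameter (U i) / L \<le> Inf ?S"
        proof (rule cInf_greatest[OF False])
          fix t assume "t \<in> ?S"
          then show "s - diameter (U i) / L \<le> t" using diam[OF s] by fastforce
        qed
        then show "s \<le> Inf ?S + diameter (U i) / L" by simp
      qed
      then have "L * (Sup ?S - Inf ?S) \<le> diameter (U i)"
        using L by (simp add: field_simps)
      moreover have "Inf ?S \<le> Sup ?S" using in_I[OF s0] by simp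
      ultimately show ?thesis using in_I by blast
    qed
    then obtain a b where ab: "\<And>i. a i \<le> b i" "\<And>i. g -` U i \<subseteq> {a i..b i}"
      "\<And>i. L * (b i - a i) \<le> diameter (U i)"
      by metis
    have "B \<subseteq> (\<Union>i. {a i..b i})"
    proof
      fix s assume "s \<in> B"
      then obtain i where "g s \<in> U i" using cover by blast
      then show "s \<in> (\<Union>i. {a i..b i})" using ab(2)[of i] by blast
    qed
    then have "emeasure lborel B \<le> emeasure lborel (\<Union>i. {a i..b i})"
      by (intro emeasure_mono) auto
    also have "\<dots> \<le> (\<Sum>i. emeasure lborel {a i..b i})"
      by (intro emeasure_subadditive_countably) auto
    finally have "ennreal L * emeasure lborel B \<le> (\<Sum>i. ennreal L * emeasure lborel {a i..b i})"
      by (simp add: mult_left_mono)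
    also have "\<dots> = (\<Sum>i. ennreal (L * (b i - a i)))"
      using ab(1) L by (simp add: ennreal_mult del: ennreal_suminf_cmult)
    also have "\<dots> \<le> (\<Sum>i. ennreal (diameter (U i)))"
      by (intro suminf_le ennreal_leI ab) auto
    finally show "ennreal L * emeasure lborel B \<le> (\<Sum>i. ennreal (diameter (U i)))" .
  qed
  also have "\<dots> \<le> hausdorff1_outer (g ` B)"
    unfolding hausdorff1_outer_def by (intro SUP_upper) simp
  finally show ?thesis .
qed

text \<open>Cutting the interval into \<open>n\<close> equal pieces gives covers of arbitrarily
  small mesh whose diameters sum to at most \<open>L * (b - a)\<close>.\<close>

lemma hausdorff1_outer_scaled_isometry_Icc_le:
  fixes g :: "real \<Rightarrow> 'a::metric_space"
  assumes L: "0 < L" and g: "\<And>s t. dist (g s) (g t) = L * \<bar>s - t\<bar>" and ab: "a \<le> b"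
  shows "hausdorff1_outer (g ` {a..b}) \<le> ennreal (L * (b - a))"
  unfolding hausdorff1_outer_def
proof (rule SUP_least)
  fix \<delta> :: real assume "\<delta> \<in> {0<..}"
  then have \<delta>: "0 < \<delta>" by simp
  \<comment> \<open>This choice makes the image of each piece, of diameter at most
    \<open>L * w\<close>, small enough for \<open>\<delta>\<close>.\<close>
  obtain n :: nat where n: "L * (b - a) / \<delta> < real n"
    using reals_Archimedean2 by blast
  have "0 \<le> L * (b - a) / \<delta>" using L ab \<delta> by simp
  with n have n0: "0 < real n" by linarith
  define w where "w = (b - a) / real n"
  have w: "0 \<le> w" "L * w \<le> \<delta>" "real n * w = b - a"
    using ab n n0 \<delta> by (auto simp: w_def field_simps)
  define U where "U i = (if i < n then g ` {a + real i * w..a + real (Suc i) * w} else {})" for i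
  have bdd: "bounded (U i)" for i
  proof -
    have "dist (g a) y \<le> L * \<bar>a + real (Suc i) * w - a\<bar> + L * w" if "y \<in> U i" for y
    proof -
      obtain s where s: "y = g s" "a + real i * w \<le> s" "s \<le> a + real (Suc i) * w"
        using \<open>y \<in> U i\<close> by (auto simp: U_def split: if_splits)
      have "0 \<le> real i * w" using w by simp
      moreover have "real (Suc i) * w = real i * w + w" by (simp add: algebra_simps)
      ultimately have "\<bar>a - s\<bar> \<le> \<bar>a + real (Suc i) * w - a\<bar> + w"
        using s w by linarith
      then have "L * \<bar>a - s\<bar> \<le> L * (\<bar>a + real (Suc i) * w - a\<bar> + w)"
        using L by simp
      then show ?thesis using s g[of a s] by (simp add: distrib_left)
    qed
    then show ?thesis unfolding bounded_def by blast
  qed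
  have diam: "diameter (U i) \<le> L * w" for i
  proof (cases "i < n")
    case True
    have "dist x y \<le> L * w" if "x \<in> U i" "y \<in> U i" for x y
    proof -
      from that True obtain s t where "x = g s" "y = g t"
        "s \<in> {a + real i * w..a + real (Suc i) * w}"
        "t \<in> {a + real i * w..a + real (Suc i) * w}"
        by (auto simp: U_def)
      then show ?thesis using L w g[of s t] by (auto simp: algebra_simps abs_le_iff)
    qed
    moreover have "U i \<noteq> {}" using True w by (auto simp: U_def algebra_simps)
    ultimately show ?thesis
      by (auto simp: diameter_def intro!: cSUP_least)
  next
    case False
    then show ?thesis using L w by (simp add: U_def)
  qed
  have "hausdorff1_delta \<delta> (g ` {a..b}) \<le> (\<Sum>i. ennreal (diameter (U i)))"
  proof (rule hausdorff1_delta_le[OF _ bdd])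
    show "g ` {a..b} \<subseteq> (\<Union>i. U i)"
    proof (clarsimp)
      fix s assume s: "a \<le> s" "s \<le> b"
      have "\<exists>i<n. a + real i * w \<le> s \<and> s \<le> a + real (Suc i) * w"
      proof -
        have ex: "\<exists>k. s \<le> a + real (Suc k) * w \<and> k < n"
          using s w n0 by (intro exI[of _ "n - 1"]) auto
        define k where "k = (LEAST k. s \<le> a + real (Suc k) * w \<and> k < n)"
        have k: "s \<le> a + real (Suc k) * w \<and> k < n"
          unfolding k_def by (rule LeastI_ex[OF ex])
        have "a + real k * w \<le> s"
        proof (cases k)
          case 0 then show ?thesis using s by simp
        next
          case (Suc j)
          then have "\<not> (s \<le> a + real (Suc j) * w \<and> j < n)"
            using not_less_Least[of j "\<lambda>k. s \<le> a + real (Suc k) * w \<and> k < n"] by (simp add: k_def)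
          then show ?thesis using k Suc by simp
        qed
        then show ?thesis using k by blast
      qed
      then obtain i where "i < n" "s \<in> {a + real i * w..a + real (Suc i) * w}" by auto
      then have "g s \<in> U i" by (simp only: U_def if_True imageI)
      then show "\<exists>i. g s \<in> U i" ..
    qed
    show "diameter (U i) \<le> \<delta>" for i using diam[of i] w by linarith
  qed
  also have "\<dots> = (\<Sum>i<n. ennreal (diameter (U i)))"
    by (rule suminf_finite) (auto simp: U_def)
  also have "\<dots> \<le> (\<Sum>i<n. ennreal (L * w))"
    by (intro sum_mono ennreal_leI diam)
  also have "\<dots> = ennreal (real n * (L * w))"
    by (simp add: ennreal_of_nat_eq_real_of_nat ennreal_mult')
  also have "real n * (L * w) = L * (b - a)"
    unfolding w(3)[symmetric] by simp
  finally show "hausdorff1_delta \<delta> (g ` {a..b}) \<le> ennreal (L * (b - a))" .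
qed

text \<open>The lower bound is known for Borel sets but the upper one only for intervals. So two
  finite measures on the line are compared on half-lines, which determine them. The measurable left
  inverse \<open>h\<close> carries Hausdorff measure back to the parameter.\<close>

lemma emeasure_hausdorff1_scaled_isometry:
  fixes g :: "real \<Rightarrow> 'a::metric_space" and h :: "'a \<Rightarrow> real"
  assumes L: "0 < L" and g: "\<And>s t. dist (g s) (g t) = L * \<bar>s - t\<bar>"
    and h[measurable]: "h \<in> borel_measurable borel" and hg: "\<And>s. h (g s) = s"
    and A[measurable]: "A \<in> sets borel"
  shows "emeasure hausdorff1 (A \<inter> g ` {a..b}) = ennreal L * emeasure lborel (g -` A \<inter> {a..b})"
proof -
  have "L-lipschitz_on UNIV g"
    using L g by (auto simp: lipschitz_on_def dist_real_def)
  then have cont: "continuous_on UNIV g"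
    by (rule lipschitz_on_continuous_on)
  then have [measurable]: "g \<in> borel_measurable borel"
    by (rule borel_measurable_continuous_onI)
  have "compact (g ` {a..b})"
    by (intro compact_continuous_image continuous_on_subset[OF cont]) auto
  then have S[measurable]: "g ` {a..b} \<in> sets borel" by (simp add: borel_compact)
  have inj: "inj g" using hg by (rule inj_on_inverseI)
  \<comment> \<open>\<open>M\<close> is the Hausdorff measure on the segment read in the parameter,
    \<open>N\<close> is \<open>L\<close> times Lebesgue measure on \<open>{a..b}\<close>.\<close>
  define M where "M = distr (density hausdorff1 (indicator (g ` {a..b}))) borel h"
  define N where "N = density lborel (\<lambda>s. ennreal L * indicator {a..b} s)"
  have img: "g ` (B \<inter> {a..b}) = g ` {a..b} \<inter> h -` B" for B by (auto simp: hg)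
  have img_borel: "g ` (B \<inter> {a..b}) \<in> sets borel" if "B \<in> sets borel" for B
    using measurable_sets[OF h that] by (auto simp: img)
  have Mem: "emeasure M B = emeasure hausdorff1 (g ` (B \<inter> {a..b}))" if B: "B \<in> sets borel" for B
  proof -
    have hB: "h -` B \<in> sets borel"
      using measurable_sets[OF h B] by simp
    have "emeasure M B = emeasure (density hausdorff1 (indicator (g ` {a..b}))) (h -` B)"
      unfolding M_def using B by (subst emeasure_distr) auto
    also have "\<dots> = emeasure hausdorff1 (g ` {a..b} \<inter> h -` B)"
      using hB by (subst emeasure_density) (auto simp: indicator_inter_arith[symmetric])
    finally show ?thesis by (simp add: img)
  qed
  have Nem: "emeasure N B = ennreal L * emeasure lborel (B \<inter> {a..b})"
    if [measurable]: "B \<in> sets borel" for B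
  proof -
    have "emeasure N B = (\<integral>\<^sup>+ s. ennreal L * indicator (B \<inter> {a..b}) s \<partial>lborel)"
      unfolding N_def
      by (subst emeasure_density) (auto intro!: nn_integral_cong simp: indicator_def)
    then show ?thesis by (simp add: nn_integral_cmult)
  qed
  have "M = N"
  proof (rule measure_eqI_lessThan)
    fix x
    have Mx: "emeasure M {x<..} = hausdorff1_outer (g ` ({x<..} \<inter> {a..b}))"
      by (simp add: Mem emeasure_hausdorff1 img_borel)
    show eq: "emeasure M {x<..} = emeasure N {x<..}"
    proof (rule antisym)
      show "emeasure N {x<..} \<le> emeasure M {x<..}"
        unfolding Mx by (simp add: Nem hausdorff1_outer_scaled_isometry_ge[OF L g])
      show "emeasure M {x<..} \<le> emeasure N {x<..}"
      proof (cases "max x a < b")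
        case True
        have "emeasure M {x<..} \<le> emeasure hausdorff1 (g ` {max x a..b})"
          using img_borel[of "{max x a..b}"]
          by (auto simp: Mem Int_absorb2 intro!: emeasure_mono image_mono)
        also have "\<dots> = hausdorff1_outer (g ` {max x a..b})"
          using img_borel[of "{max x a..b}"] by (simp add: emeasure_hausdorff1 Int_absorb2)
        also have "\<dots> \<le> ennreal (L * (b - max x a))"
          using True by (intro hausdorff1_outer_scaled_isometry_Icc_le[OF L g]) simp
        also have "\<dots> = ennreal L * emeasure lborel {max x a<..b}"
          using True L by (simp add: ennreal_mult)
        also have "\<dots> \<le> ennreal L * emeasure lborel ({x<..} \<inter> {a..b})"
          by (intro mult_left_mono emeasure_mono) auto
        finally show ?thesis by (simp add: Nem)
      next
        \<comment> \<open>At most the point \<open>b\<close> remains, whose image has measure 0; the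
          case \<open>b \<le> a\<close> is included.\<close>
        case False
        then have "{x<..} \<inter> {a..b} \<subseteq> {b..b}" by auto
        then have "emeasure M {x<..} \<le> emeasure hausdorff1 (g ` {b..b})"
          by (auto simp: Mem intro!: emeasure_mono image_mono)
        also have "\<dots> = hausdorff1_outer (g ` {b..b})"
          by (simp add: emeasure_hausdorff1)
        also have "\<dots> \<le> ennreal (L * (b - b))"
          by (intro hausdorff1_outer_scaled_isometry_Icc_le[OF L g]) simp
        finally show ?thesis by simp
      qed
    qed
    have "emeasure N {x<..} \<le> ennreal L * emeasure lborel {a..b}"
      by (auto simp: Nem intro!: mult_left_mono emeasure_mono)
    also have "\<dots> < \<infinity>"
      by (simp add: ennreal_mult_less_top emeasure_lborel_Icc_eq)
    finally show "emeasure M {x<..} < \<infinity>"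
      unfolding eq .
  qed (simp_all add: M_def N_def)
  have "A \<inter> g ` {a..b} = g ` ((g -` A) \<inter> {a..b})" by auto
  then show ?thesis
    using Mem[of "g -` A"] Nem[of "g -` A"] measurable_sets[of g borel borel A] \<open>M = N\<close> by simp
qed

section \<open>Arclength on \<open>Gam t\<close> through a parametrisation\<close>

text \<open>As \<open>sgn 0 = 0\<close>, the point \<open>Gam_param t 0 = (-1, 0)\<close> lies on \<^term>\<open>Gam t\<close> only for
  \<open>t = 0\<close>; this is a single parameter, hence negligible.\<close>

definition Gam_param :: "real \<Rightarrow> real \<Rightarrow> real \<times> real" where
  "Gam_param t u = (\<bar>u\<bar> - 1, sgn u * (1 + (\<bar>u\<bar> - 1) * (1 - 2 * t)) / 2)"

lemma Gam_param_measurable [measurable]: "Gam_param t \<in> borel_measurable borel"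
  unfolding Gam_param_def by measurable

text \<open>The line through one branch: \<open>Gam_param t u = Gam_line (sgn u) t u\<close> for nonzero \<open>u\<close>.\<close>

definition Gam_line :: "real \<Rightarrow> real \<Rightarrow> real \<Rightarrow> real \<times> real" where
  "Gam_line e t u = (e * u - 1, e * (1 + (e * u - 1) * (1 - 2 * t)) / 2)"

text \<open>The speed does not depend on the sign \<open>e\<close>, so both branches carry equal
  mass per unit of parameter.\<close>

lemma dist_Gam_line:
  assumes "\<bar>e\<bar> = 1"
  shows "dist (Gam_line e t u) (Gam_line e t v) = sqrt (1 + (1 - 2 * t)\<^sup>2 / 4) * \<bar>u - v\<bar>"
proof -
  have "(e * u - 1 - (e * v - 1))\<^sup>2
      + (e * (1 + (e * u - 1) * (1 - 2 * t)) / 2 - e * (1 + (e * v - 1) * (1 - 2 * t)) / 2)\<^sup>2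
     = (1 + (1 - 2 * t)\<^sup>2 / 4) * (u - v)\<^sup>2"
    using assms by (auto simp: abs_if field_simps power2_eq_square split: if_splits)
  then show ?thesis
    by (simp add: dist_Pair_Pair Gam_line_def dist_real_def real_sqrt_mult)
qed

lemma closed_segment_eq_image_affine:
  fixes a b :: real and p q :: "'a::real_vector"
  assumes "a < b"
  shows "closed_segment p q
       = (\<lambda>s. ((b - s) / (b - a)) *\<^sub>R p + ((s - a) / (b - a)) *\<^sub>R q) ` {a..b}"
    (is "_ = ?g ` _")
proof safe
  fix x assume "x \<in> closed_segment p q"
  then obtain u where u: "x = (1 - u) *\<^sub>R p + u *\<^sub>R q" "0 \<le> u" "u \<le> 1"
    by (auto simp: closed_segment_def)
  have "(b - (a + u * (b - a))) / (b - a) = 1 - u" "(a + u * (b - a) - a) / (b - a) = u"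
    using assms(1) by (auto simp: field_simps)
  then have "x = ?g (a + u * (b - a))" using u by simp
  moreover have "u * (b - a) \<le> b - a" "0 \<le> u * (b - a)"
    using u assms(1) by (auto intro: mult_left_le_one_le)
  then have "a + u * (b - a) \<in> {a..b}" by simp
  ultimately show "x \<in> ?g ` {a..b}" by blast
next
  fix s assume "s \<in> {a..b}"
  moreover have "(b - s) / (b - a) = 1 - (s - a) / (b - a)"
    using assms(1) by (simp add: field_simps)
  ultimately show "?g s \<in> closed_segment p q"
    using assms by (auto simp: closed_segment_def intro!: exI[of _ "(s - a) / (b - a)"])
qed

lemma Gam_plus_eq: "Gam_plus t = Gam_line 1 t ` {0..2}"
  unfolding Gam_plus_def
  by (subst closed_segment_eq_image_affine[of 0 2])
    (auto intro!: image_cong simp: Gam_line_def field_simps)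

lemma Gam_minus_eq: "Gam_minus t = Gam_line (-1) t ` {-2..0}"
  \<comment> \<open>The segment is reversed: the parameter -2 belongs to the right end and 0 to the
    left end.\<close>
  unfolding Gam_minus_def closed_segment_commute[of "(-1, _)"]
  by (subst closed_segment_eq_image_affine[of "-2" 0])
    (auto intro!: image_cong simp: Gam_line_def field_simps)

lemma emeasure_hausdorff1_Gam_line:
  assumes e: "\<bar>e\<bar> = 1" and A: "A \<in> sets borel"
  shows "emeasure hausdorff1 (A \<inter> Gam_line e t ` {a..b})
       = ennreal (sqrt (1 + (1 - 2 * t)\<^sup>2 / 4)) * emeasure lborel (Gam_line e t -` A \<inter> {a..b})"
proof (rule emeasure_hausdorff1_scaled_isometry[where h="\<lambda>x. e * (fst x + 1)"])
  show "0 < sqrt (1 + (1 - 2 * t)\<^sup>2 / 4)"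
    by (simp add: add_pos_nonneg)
  show "e * (fst (Gam_line e t s) + 1) = s" for s
    using e by (auto simp: Gam_line_def abs_if split: if_splits)
  show "(\<lambda>x. e * (fst x + 1)) \<in> borel_measurable borel"
    by (intro borel_measurable_continuous_onI continuous_intros)
qed (use dist_Gam_line[OF e] A in auto)

text \<open>Equal abscissae force opposite parameters and hence opposite ordinates, so a common
  point has ordinate 0. Twice the ordinate is a sum of two nonnegative terms, and both vanish only
  at an end of the branch.\<close>

lemma Gam_plus_Int_minus:
  assumes "t \<in> {0..1}"
  shows "Gam_plus t \<inter> Gam_minus t \<subseteq> {(-1, 0), (1, 0)}"
proof 
  fix x assume "x \<in> Gam_plus t \<inter> Gam_minus t"
  then have "x \<in> Gam_plus t" "x \<in> Gam_minus t" by auto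
  then obtain u v where "x = Gam_line 1 t u" "u \<in> {0..2}" "x = Gam_line (-1) t v" "v \<in> {-2..0}"
    unfolding Gam_plus_eq Gam_minus_eq by (elim imageE)
  then have u: "x = Gam_line 1 t u" "0 \<le> u" "u \<le> 2"
    and v: "x = Gam_line (-1) t v" "-2 \<le> v" "v \<le> 0"
    by simp_all
  then have "v = - u" by (simp add: Gam_line_def)
  with u v have z: "1 + (u - 1) * (1 - 2 * t) = 0" by (auto simp: Gam_line_def)
  have "1 + (u - 1) * (1 - 2 * t) = u * (1 - t) + (2 - u) * t" by (simp add: algebra_simps)
  moreover have "0 \<le> u * (1 - t)" "0 \<le> (2 - u) * t" using assms u by auto
  ultimately have "u * (1 - t) = 0" "(2 - u) * t = 0" using z by linarith+
  then have "u = 0 \<or> u = 2" by auto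
  then show "x \<in> {(-1, 0), (1, 0)}" using u(1) z by (auto simp: Gam_line_def)
qed

text \<open>The branches overlap in a null set, so their measures add. Since they share the same
  speed, the two parameter intervals join into one, up to the negligible parameter 0.\<close>

lemma emeasure_hausdorff1_Gam:
  assumes t: "t \<in> {0..1}" and A: "A \<in> sets borel"
  shows "emeasure hausdorff1 (A \<inter> Gam t)
       = ennreal (sqrt (1 + (1 - 2 * t)\<^sup>2 / 4)) * emeasure lborel (Gam_param t -` A \<inter> {-2..2})"
    (is "_ = ?L * _")
proof -
  have [measurable]: "Gam_param t -` A \<in> sets borel"
    using measurable_sets[OF Gam_param_measurable A] by simp
  have [measurable]: "Gam_line e t \<in> borel_measurable borel" for e
    unfolding Gam_line_def by measurable
  then have [measurable]: "Gam_line e t -` A \<in> sets borel" for e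
    using measurable_sets[of "Gam_line e t" borel borel A] A by simp
  have seg[measurable]: "Gam_plus t \<in> sets borel" "Gam_minus t \<in> sets borel"
    by (auto simp: Gam_plus_def Gam_minus_def intro: borel_closed)
  note A[measurable]
  have pt: "emeasure hausdorff1 {x} = 0" if x: "x \<in> Gam_plus t" for x
  proof -
    obtain u where u: "x = Gam_line 1 t u" using x unfolding Gam_plus_eq by blast
    have "{x} = {x} \<inter> Gam_line 1 t ` {u..u}" using u by auto
    also have "emeasure hausdorff1 \<dots> = ?L * emeasure lborel (Gam_line 1 t -` {x} \<inter> {u..u})"
      by (rule emeasure_hausdorff1_Gam_line) auto
    also have "\<dots> \<le> ?L * emeasure lborel {u..u}"
      by (intro mult_left_mono emeasure_mono) auto
    finally show ?thesis by simp
  qed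
  have null: "A \<inter> Gam_plus t \<inter> Gam_minus t \<in> null_sets hausdorff1"
  proof (rule null_sets_subset)
    show "Gam_plus t \<inter> {(-1, 0), (1, 0)} \<in> null_sets hausdorff1"
    proof -
      have "(\<Union>x\<in>Gam_plus t \<inter> {(-1, 0), (1, 0)}. {x}) \<in> null_sets hausdorff1"
        by (rule null_sets_UN') (auto intro!: null_setsI pt)
      then show ?thesis by simp
    qed
  qed (use Gam_plus_Int_minus[OF t] in auto)
  have "emeasure hausdorff1 (A \<inter> Gam t)
      = emeasure hausdorff1 ((A \<inter> Gam_plus t) \<union> (A \<inter> Gam_minus t))"
    by (simp add: Gam_def Int_Un_distrib)
  also have "\<dots> = emeasure hausdorff1 (A \<inter> Gam_plus t) + emeasure hausdorff1 (A \<inter> Gam_minus t)"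
    using null by (intro emeasure_Un') (auto simp: Int_ac)
  also have "\<dots> = ?L * (emeasure lborel (Gam_line 1 t -` A \<inter> {0..2})
                     + emeasure lborel (Gam_line (-1) t -` A \<inter> {-2..0}))"
    unfolding Gam_plus_eq Gam_minus_eq
    by (simp add: emeasure_hausdorff1_Gam_line A distrib_left)
  also have "emeasure lborel (Gam_line 1 t -` A \<inter> {0..2})
      = emeasure lborel (Gam_param t -` A \<inter> {0<..2})"
    using AE_lborel_singleton[of "0::real"]
    by (intro emeasure_eq_AE) (auto simp: Gam_line_def Gam_param_def elim!: eventually_mono)
  also have "emeasure lborel (Gam_line (-1) t -` A \<inter> {-2..0})
      = emeasure lborel (Gam_param t -` A \<inter> {-2..<0})"
    using AE_lborel_singleton[of "0::real"]
    by (intro emeasure_eq_AE) (auto simp: Gam_line_def Gam_param_def elim!: eventually_mono)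
  also have "emeasure lborel (Gam_param t -` A \<inter> {0<..2})
        + emeasure lborel (Gam_param t -` A \<inter> {-2..<0})
      = emeasure lborel ((Gam_param t -` A \<inter> {0<..2}) \<union> (Gam_param t -` A \<inter> {-2..<0}))"
    by (intro plus_emeasure) auto
  also have "\<dots> = emeasure lborel (Gam_param t -` A \<inter> {-2..2})"
    using AE_lborel_singleton[of "0::real"]
    by (intro emeasure_eq_AE) (auto elim!: eventually_mono)
  finally show ?thesis .
qed

text \<open>The total length is the preceding formula for \<open>UNIV\<close>, so the common speed
  cancels in the quotient.\<close>

lemma normalized_arclength_Gam:
  assumes t: "t \<in> {0..1}"
  shows "normalized_arclength (Gam t) = distr (uniform_measure lborel {-2..2}) borel (Gam_param t)"
proof (rule measure_eqI)
  fix A assume "A \<in> sets (normalized_arclength (Gam t))"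
  then have A[measurable]: "A \<in> sets borel" by (simp add: normalized_arclength_def)
  let ?L = "ennreal (sqrt (1 + (1 - 2 * t)\<^sup>2 / 4))"
  have "0 < sqrt (1 + (1 - 2 * t)\<^sup>2 / 4)"
    by (simp add: add_pos_nonneg)
  then have L: "?L \<noteq> 0" "?L \<noteq> top" by simp_all
  have vA: "Gam_param t -` A \<in> sets borel"
    using measurable_sets[OF Gam_param_measurable A] by simp
  have S: "Gam t \<in> sets borel"
    by (auto simp: Gam_def Gam_plus_def Gam_minus_def intro!: borel_closed)
  have "emeasure (normalized_arclength (Gam t)) A
      = emeasure hausdorff1 (A \<inter> Gam t) / emeasure hausdorff1 (UNIV \<inter> Gam t)"
    using S by (simp add: normalized_arclength_def Int_commute)
  also have "\<dots> = (?L * emeasure lborel (Gam_param t -` A \<inter> {-2..2}))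
      / (?L * emeasure lborel ({-2..2} :: real set))"
    by (subst (1 2) emeasure_hausdorff1_Gam[OF t]) auto
  also have "\<dots> = emeasure lborel (Gam_param t -` A \<inter> {-2..2})
      / emeasure lborel ({-2..2} :: real set)"
    using L by (simp add: mult.commute[of ?L] divide_mult_eq)
  also have "\<dots> = emeasure (distr (uniform_measure lborel {-2..2}) borel (Gam_param t)) A"
    using vA by (subst emeasure_distr) (auto simp: Int_commute)
  finally show "emeasure (normalized_arclength (Gam t)) A
      = emeasure (distr (uniform_measure lborel {-2..2}) borel (Gam_param t)) A" .
qed (simp add: normalized_arclength_def)

subsection \<open>Optimality by duality\<close>

text \<open>Complementary slackness: the potentials \<open>\<phi>\<close> and \<open>\<psi>\<close> bound the cost from below by the same
  constant for all couplings, and equality forces a coupling onto the graph of \<open>T\<close>.\<close>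

lemma quadratic_optimal_coupling_iff_graph:
  fixes \<mu> \<nu> :: "'a::euclidean_space measure" and T :: "'a \<Rightarrow> 'a" and \<phi> \<psi> :: "'a \<Rightarrow> real"
  assumes [measurable_cong, simp]: "sets \<mu> = sets borel" "sets \<nu> = sets borel"
    and T[measurable]: "T \<in> borel_measurable borel" and push: "distr \<mu> borel T = \<nu>"
    and [measurable]: "\<phi> \<in> borel_measurable borel" "\<psi> \<in> borel_measurable borel"
    and nonneg: "\<And>x. 0 \<le> \<phi> x" "\<And>y. 0 \<le> \<psi> y"
    and fin: "(\<integral>\<^sup>+x. \<phi> x \<partial>\<mu>) < \<infinity>" "(\<integral>\<^sup>+y. \<psi> y \<partial>\<nu>) < \<infinity>"
    and conc: "AE x in \<mu>. x \<in> S" "AE y in \<nu>. y \<in> S'"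
    and lower: "\<And>x y. x \<in> S \<Longrightarrow> y \<in> S' \<Longrightarrow> \<phi> x + \<psi> y \<le> (norm (x - y))\<^sup>2"
    and eq: "\<And>x y. x \<in> S \<Longrightarrow> y \<in> S' \<Longrightarrow> \<phi> x + \<psi> y = (norm (x - y))\<^sup>2 \<longleftrightarrow> y = T x"
  shows "quadratic_optimal_coupling \<mu> \<nu> \<pi> \<longleftrightarrow> \<pi> = distr \<mu> (borel \<Otimes>\<^sub>M borel) (\<lambda>x. (x, T x))"
proof -
  define C where "C = (\<integral>\<^sup>+x. \<phi> x \<partial>\<mu>) + (\<integral>\<^sup>+y. \<psi> y \<partial>\<nu>)"
  have C: "C \<noteq> top" using fin by (simp add: C_def less_top)
  define G where "G = distr \<mu> (borel \<Otimes>\<^sub>M borel) (\<lambda>x. (x, T x))"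
  have sets_pair: "sets (\<mu> \<Otimes>\<^sub>M \<nu>) = sets (borel \<Otimes>\<^sub>M borel)"
    by (rule sets_pair_measure_cong) auto
  have coupl: "sets \<rho> = sets (borel \<Otimes>\<^sub>M borel)" "distr \<rho> borel fst = \<mu>" "distr \<rho> borel snd = \<nu>"
    if "\<rho> \<in> couplings \<mu> \<nu>" for \<rho>
  proof -
    show "sets \<rho> = sets (borel \<Otimes>\<^sub>M borel)"
      using that by (simp add: couplings_def sets_pair)
    have "distr \<rho> borel fst = distr \<rho> \<mu> fst" "distr \<rho> borel snd = distr \<rho> \<nu> snd"
      by (rule distr_cong; simp)+
    then show "distr \<rho> borel fst = \<mu>" "distr \<rho> borel snd = \<nu>"
      using that by (auto simp: couplings_def)
  qed
  have cost: "quadratic_cost \<rho> = C + (\<integral>\<^sup>+(x, y). ennreal ((norm (x - y))\<^sup>2 - \<phi> x - \<psi> y) \<partial>\<rho>)"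
    and conc_pair: "AE (x, y) in \<rho>. x \<in> S \<and> y \<in> S'"
    if \<rho>: "\<rho> \<in> couplings \<mu> \<nu>" for \<rho>
  proof -
    note [measurable_cong] = coupl(1)[OF \<rho>]
    have "AE p in \<rho>. fst p \<in> S" "AE p in \<rho>. snd p \<in> S'"
      using conc coupl(2,3)[OF \<rho>]
      by (auto intro!: AE_distrD[where M'=borel and f=fst] AE_distrD[where M'=borel and f=snd])
    then show conc: "AE (x, y) in \<rho>. x \<in> S \<and> y \<in> S'"
      by eventually_elim auto
    have "(\<integral>\<^sup>+(x, y). ennreal (\<phi> x) \<partial>\<rho>) = (\<integral>\<^sup>+x. \<phi> x \<partial>distr \<rho> borel fst)"
      by (subst nn_integral_distr) (auto simp: case_prod_unfold)
    moreover have "(\<integral>\<^sup>+(x, y). ennreal (\<psi> y) \<partial>\<rho>) = (\<integral>\<^sup>+y. \<psi> y \<partial>distr \<rho> borel snd)"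
      by (subst nn_integral_distr) (auto simp: case_prod_unfold)
    ultimately have C_eq: "C = (\<integral>\<^sup>+(x, y). ennreal (\<phi> x) \<partial>\<rho>) + (\<integral>\<^sup>+(x, y). ennreal (\<psi> y) \<partial>\<rho>)"
      by (simp add: C_def coupl(2,3)[OF \<rho>])
    \<comment> \<open>\<open>ennreal\<close> sends negative reals to 0, so the cost splits only
      where \<open>lower\<close> applies, which is almost everywhere by \<open>conc\<close>.\<close>
    have "quadratic_cost \<rho> = (\<integral>\<^sup>+(x, y). ennreal (\<phi> x) + ennreal (\<psi> y)
        + ennreal ((norm (x - y))\<^sup>2 - \<phi> x - \<psi> y) \<partial>\<rho>)"
      unfolding quadratic_cost_def
    proof (rule nn_integral_cong_AE, use conc in eventually_elim)
      case (elim p)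
      then show ?case
        using lower[of "fst p" "snd p"] nonneg
        by (auto simp: case_prod_unfold simp flip: ennreal_plus)
    qed
    also have "\<dots> = C + (\<integral>\<^sup>+(x, y). ennreal ((norm (x - y))\<^sup>2 - \<phi> x - \<psi> y) \<partial>\<rho>)"
      unfolding C_eq case_prod_unfold by (simp add: nn_integral_add)
    finally show "quadratic_cost \<rho> = C + (\<integral>\<^sup>+(x, y). ennreal ((norm (x - y))\<^sup>2 - \<phi> x - \<psi> y) \<partial>\<rho>)" .
  qed
  have G: "G \<in> couplings \<mu> \<nu>"
  proof -
    have "distr G \<mu> fst = distr \<mu> \<mu> (\<lambda>x. x)"
      unfolding G_def by (subst distr_distr) (auto simp: comp_def)
    moreover have "distr G \<nu> snd = distr \<mu> \<nu> T"
      unfolding G_def by (subst distr_distr) (auto simp: comp_def)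
    moreover have "distr \<mu> \<nu> T = distr \<mu> borel T"
      by (rule distr_cong) auto
    ultimately show ?thesis
      by (simp add: couplings_def sets_pair push distr_id2) (simp add: G_def)
  qed
  have slack_G: "(\<integral>\<^sup>+(x, y). ennreal ((norm (x - y))\<^sup>2 - \<phi> x - \<psi> y) \<partial>G) = 0"
  proof -
    \<comment> \<open>That \<open>T x\<close> lies in \<open>S'\<close> almost everywhere comes from
      the second marginal of \<open>G\<close>.\<close>
    have "AE (x, y) in G. x \<in> S \<and> y \<in> S'" by (rule conc_pair[OF G])
    then have "AE x in \<mu>. x \<in> S \<and> T x \<in> S'"
      unfolding G_def by (drule_tac AE_distrD[rotated]) auto
    then have "AE x in \<mu>. ennreal ((norm (x - T x))\<^sup>2 - \<phi> x - \<psi> (T x)) = 0"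
    proof eventually_elim
      case (elim x)
      then show ?case using eq[of x "T x"] by simp
    qed
    then show ?thesis
      unfolding G_def case_prod_unfold by (simp add: nn_integral_distr nn_integral_0_iff_AE)
  qed
  show ?thesis
    unfolding G_def[symmetric]
  proof
    assume "\<pi> = G"
    then show "quadratic_optimal_coupling \<mu> \<nu> \<pi>"
      using G cost slack_G by (auto simp: quadratic_optimal_coupling_def)
  next
    assume opt: "quadratic_optimal_coupling \<mu> \<nu> \<pi>"
    then have \<pi>: "\<pi> \<in> couplings \<mu> \<nu>" by (simp add: quadratic_optimal_coupling_def)
    note [measurable_cong] = coupl(1)[OF \<pi>]
    have "quadratic_cost \<pi> \<le> C + 0"
      using opt G cost[OF G] slack_G by (auto simp: quadratic_optimal_coupling_def)
    \<comment> \<open>Finiteness of \<open>C\<close> allows it to be cancelled, so the nonnegative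
      slack of an optimal coupling integrates to 0.\<close>
    then have "(\<integral>\<^sup>+(x, y). ennreal ((norm (x - y))\<^sup>2 - \<phi> x - \<psi> y) \<partial>\<pi>) = 0"
      unfolding cost[OF \<pi>] using C by (simp add: ennreal_add_left_cancel_le)
    then have "AE p in \<pi>. ennreal ((norm (fst p - snd p))\<^sup>2 - \<phi> (fst p) - \<psi> (snd p)) = 0"
      unfolding case_prod_unfold by (subst (asm) nn_integral_0_iff_AE) auto
    with conc_pair[OF \<pi>] have graph: "AE p in \<pi>. p = (fst p, T (fst p))"
    proof eventually_elim
      case (elim p)
      then show ?case
        using eq[of "fst p" "snd p"] lower[of "fst p" "snd p"]
        by (auto simp: case_prod_unfold prod_eq_iff)
    qed
    have "\<pi> = distr \<pi> (borel \<Otimes>\<^sub>M borel) (\<lambda>p. p)"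
      by (rule distr_id2[symmetric]) (simp add: coupl(1)[OF \<pi>])
    also have "\<dots> = distr \<pi> (borel \<Otimes>\<^sub>M borel) (\<lambda>p. (fst p, T (fst p)))"
      using graph by (intro distr_cong_AE) auto
    also have "\<dots> = distr (distr \<pi> borel fst) (borel \<Otimes>\<^sub>M borel) (\<lambda>x. (x, T x))"
      by (subst distr_distr) (auto simp: comp_def)
    also have "\<dots> = G" by (simp add: G_def coupl(2)[OF \<pi>])
    finally show "\<pi> = G" .
  qed
qed

text \<open>As graphs over the ordinate, \<^term>\<open>Gam 0\<close> consists of the points \<open>(2 * \<bar>p\<bar> - 1, p)\<close> and
  \<^term>\<open>Gam 1\<close> of the points \<open>(1 - 2 * \<bar>q\<bar>, q)\<close>.\<close>

lemma
  fixes p q :: real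
  assumes p: "0 < \<bar>p\<bar>" "\<bar>p\<bar> < 1"
  defines "c \<equiv> (2 * \<bar>p\<bar> - 1 - (1 - 2 * \<bar>q\<bar>))\<^sup>2 + (p - q)\<^sup>2"
  shows quadratic_cost_ends_ge: "(2 * \<bar>p\<bar> - 1)\<^sup>2 / 2 + (1 - 2 * \<bar>q\<bar>)\<^sup>2 / 2 \<le> c"
    and quadratic_cost_ends_eq_iff:
      "(2 * \<bar>p\<bar> - 1)\<^sup>2 / 2 + (1 - 2 * \<bar>q\<bar>)\<^sup>2 / 2 = c \<longleftrightarrow> q = sgn p * (1 - \<bar>p\<bar>)"
proof -
  have pq: "p * q \<le> \<bar>p\<bar> * \<bar>q\<bar>" by (metis abs_ge_self abs_mult)
  define a d r where "a = (2 * \<bar>p\<bar> - 1)\<^sup>2 / 2 + (1 - 2 * \<bar>q\<bar>)\<^sup>2 / 2"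
    and "d = (\<bar>p\<bar> + \<bar>q\<bar> - 1)\<^sup>2" and "r = \<bar>p\<bar> * \<bar>q\<bar> - p * q"
  have nonneg: "0 \<le> d" "0 \<le> r"
    using pq by (simp_all add: d_def r_def)
  \<comment> \<open>\<open>d\<close> vanishes when the abscissae agree, \<open>r\<close> when
    \<open>p\<close> and \<open>q\<close> do not have opposite signs. At \<open>p = 0\<close>, where
    the branches of \<open>Gam 0\<close> meet, both \<open>q = 1\<close> and \<open>q = -1\<close>
    would give equality; hence the hypothesis \<open>0 < \<bar>p\<bar>\<close>.\<close>
  have decomp: "c = a + 3 * d + 2 * r"
    unfolding c_def a_def d_def r_def by (auto simp: abs_if power2_eq_square field_simps)
  have "a \<le> c" using nonneg decomp by linarith
  then show "(2 * \<bar>p\<bar> - 1)\<^sup>2 / 2 + (1 - 2 * \<bar>q\<bar>)\<^sup>2 / 2 \<le> c" by (simp add: a_def)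
  have "a = c \<longleftrightarrow> d = 0 \<and> r = 0" using nonneg decomp by linarith
  also have "\<dots> \<longleftrightarrow> q = sgn p * (1 - \<bar>p\<bar>)"
    using p by (auto simp: d_def r_def abs_if sgn_if mult_less_0_iff split: if_splits)
  finally show "(2 * \<bar>p\<bar> - 1)\<^sup>2 / 2 + (1 - 2 * \<bar>q\<bar>)\<^sup>2 / 2 = c \<longleftrightarrow> q = sgn p * (1 - \<bar>p\<bar>)"
    by (simp add: a_def)
qed

text \<open>Duality is applied with half the squared abscissa as both potentials and with the
  vertical map \<open>T\<close>, which takes \<open>Gam_param 0 u\<close> to
  \<open>Gam_param 1 u\<close>.\<close>

lemma quadratic_optimal_coupling_Gam_iff:
  "quadratic_optimal_coupling (normalized_arclength (Gam 0)) (normalized_arclength (Gam 1)) \<pi>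
   \<longleftrightarrow> \<pi> = distr (uniform_measure lborel {-2..2}) (borel \<Otimes>\<^sub>M borel)
          (\<lambda>u. (Gam_param 0 u, Gam_param 1 u))"
proof -
  define P where "P = uniform_measure lborel {-2..2::real}"
  have [measurable_cong, simp]: "sets P = sets borel" by (simp add: P_def)
  have mu: "normalized_arclength (Gam t) = distr P borel (Gam_param t)" if "t \<in> {0..1}" for t
    using normalized_arclength_Gam[OF that] by (simp add: P_def)
  have P1: "emeasure P (space P) = 1"
    by (simp add: P_def emeasure_uniform_measure)
  have [measurable]: "fst \<in> borel_measurable (borel :: (real \<times> real) measure)"
    by (intro borel_measurable_continuous_onI continuous_intros)
  define T :: "real \<times> real \<Rightarrow> real \<times> real"
    where "T x = (fst x, sgn (snd x) * (1 - \<bar>snd x\<bar>))" for x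
  have [measurable]: "T \<in> borel_measurable borel"
    unfolding T_def borel_prod[symmetric] by measurable
  have T: "T (Gam_param 0 u) = Gam_param 1 u" for u
    by (auto simp: T_def Gam_param_def sgn_if abs_if)
  \<comment> \<open>Up to the ends of the branches, \<open>S 1\<close> is \<open>Gam 0\<close> and
    \<open>S (-1)\<close> is \<open>Gam 1\<close>, which explains the index \<open>1 - 2 * t\<close>
    below.\<close>
  define S :: "real \<Rightarrow> (real \<times> real) set" where
    "S e = {x. fst x = e * (2 * \<bar>snd x\<bar> - 1) \<and> 0 < \<bar>snd x\<bar> \<and> \<bar>snd x\<bar> < 1}" for e
  have [measurable]: "S e \<in> sets borel" for e
  proof -
    have "{x \<in> space (borel \<Otimes>\<^sub>M borel). fst x = e * (2 * \<bar>snd x\<bar> - 1) \<and> 0 < \<bar>snd x\<bar> \<and> \<bar>snd x\<bar> < 1}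
        \<in> sets (borel \<Otimes>\<^sub>M borel :: (real \<times> real) measure)"
      by measurable
    then show ?thesis unfolding S_def borel_prod by simp
  qed
  \<comment> \<open>The excluded parameters 0, 2 and -2 correspond to the ends of the
    branches.\<close>
  have AE_P: "AE u in P. 0 < \<bar>u\<bar> \<and> \<bar>u\<bar> < 2"
  proof -
    have "AE u in lborel. u \<noteq> 0 \<and> u \<noteq> 2 \<and> u \<noteq> (-2 :: real)"
      by (intro AE_conjI AE_lborel_singleton)
    then have "AE u::real in lborel. u \<in> {-2..2} \<longrightarrow> 0 < \<bar>u\<bar> \<and> \<bar>u\<bar> < 2"
      by (rule eventually_mono) auto
    then show ?thesis
      unfolding P_def by (rule AE_uniform_measureI[rotated]) simp
  qed
  have conc: "AE x in distr P borel (Gam_param t). x \<in> S (1 - 2 * t)" if "t \<in> {0, 1}" for t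
  proof (subst AE_distr_iff)
    have "Gam_param t u \<in> S (1 - 2 * t)" if "0 < \<bar>u\<bar> \<and> \<bar>u\<bar> < 2" for u
      using that \<open>t \<in> {0, 1}\<close> by (auto simp: S_def Gam_param_def abs_mult abs_sgn_eq sgn_zero_iff)
    with AE_P show "AE u in P. Gam_param t u \<in> S (1 - 2 * t)"
      by (rule eventually_mono)
  qed simp_all
  have fin: "(\<integral>\<^sup>+x. ennreal ((fst x)\<^sup>2 / 2) \<partial>distr P borel (Gam_param t)) < \<infinity>" for t
  proof -
    have "(\<integral>\<^sup>+x. ennreal ((fst x)\<^sup>2 / 2) \<partial>distr P borel (Gam_param t))
        = (\<integral>\<^sup>+u. ennreal ((\<bar>u\<bar> - 1)\<^sup>2 / 2) \<partial>P)"
      by (subst nn_integral_distr) (auto simp: Gam_param_def)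
    also have "\<dots> \<le> (\<integral>\<^sup>+u. 1 \<partial>P)"
    proof (rule nn_integral_mono_AE, use AE_P in eventually_elim)
      case (elim u)
      then have "(\<bar>u\<bar> - 1)\<^sup>2 \<le> 1" unfolding abs_square_le_1 by linarith
      then show ?case by simp
    qed
    also have "\<dots> = 1" using P1 by simp
    finally show ?thesis by (rule le_less_trans) simp
  qed
  have "quadratic_optimal_coupling (distr P borel (Gam_param 0)) (distr P borel (Gam_param 1)) \<pi>
   \<longleftrightarrow> \<pi> = distr (distr P borel (Gam_param 0)) (borel \<Otimes>\<^sub>M borel) (\<lambda>x. (x, T x))"
  proof (rule quadratic_optimal_coupling_iff_graph)
    fix x y assume "x \<in> S 1" "y \<in> S (-1)"
    then obtain p q where xy: "x = (2 * \<bar>p\<bar> - 1, p)" "y = (1 - 2 * \<bar>q\<bar>, q)"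
      and p: "0 < \<bar>p\<bar>" "\<bar>p\<bar> < 1"
      by (cases x, cases y) (auto simp: S_def)
    show "(fst x)\<^sup>2 / 2 + (fst y)\<^sup>2 / 2 \<le> (norm (x - y))\<^sup>2"
      using quadratic_cost_ends_ge[OF p, of q] by (simp add: xy norm_Pair)
    show "(fst x)\<^sup>2 / 2 + (fst y)\<^sup>2 / 2 = (norm (x - y))\<^sup>2 \<longleftrightarrow> y = T x"
      using quadratic_cost_ends_eq_iff[OF p, of q] p
      by (auto simp: xy norm_Pair T_def abs_mult abs_sgn_eq)
  qed (use conc[of 0] conc[of 1] fin in \<open>auto simp: distr_distr comp_def T\<close>)
  then show ?thesis
    by (simp add: mu distr_distr comp_def T P_def)
qed

text \<open>For fixed \<open>u\<close> the abscissa and the sign are constant in \<open>t\<close>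
  and the ordinate is affine in \<open>t\<close>, so interpolating the ends gives
  \<open>Gam_param t u\<close> exactly.\<close>

lemma displacement_interpolation_Gam_param:
   "displacement_interpolation
     (distr (uniform_measure lborel {-2..2}) (borel \<Otimes>\<^sub>M borel)
       (\<lambda>u. (Gam_param 0 u, Gam_param 1 u))) t
    = distr (uniform_measure lborel {-2..2}) borel (Gam_param t)"
proof -
  have "(1 - t) *\<^sub>R Gam_param 0 u + t *\<^sub>R Gam_param 1 u = Gam_param t u" for u
    by (simp add: Gam_param_def field_simps)
  then show ?thesis
    unfolding displacement_interpolation_def by (subst distr_distr) (auto simp: comp_def)
qed

theorem proposition5p1:
  "(\<exists>!\<pi>. quadratic_optimal_coupling (normalized_arclength (Gam 0)) (normalized_arclength (Gam 1)) \<pi>) \<and>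
   (\<forall>\<pi>. quadratic_optimal_coupling (normalized_arclength (Gam 0)) (normalized_arclength (Gam 1)) \<pi> \<longrightarrow>
      (\<forall>t \<in> {0..1}. displacement_interpolation \<pi> t = normalized_arclength (Gam t)))"
  unfolding quadratic_optimal_coupling_Gam_iff
  by (simp add: displacement_interpolation_Gam_param normalized_arclength_Gam)

end
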